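(* Let $k,\ell\in\mathbb{N}$, $S\in M_{k\times\ell}(\mathbb{C})$, $(\underline{a},\underline{b})\in\mathbb{C}^{k+\ell}$, and let $V=V_{k,\ell}(S;(\underline{a},\underline{b}))$ be the corresponding calibrated representation of $A$. Suppose that $e$ does not act by $0$ on $V$. (1) Suppose $(\underline{a},\underline{b})\in\mathbb{C}^{k+\ell,\mathrm{reg}}$. Then $V$ is indecomposable if and only if $S$ is a rhizomatic matrix. (2) Suppose $\ell=1$, so $(\underline{a},b)\in\mathbb{C}^{k+1}$. Then $V$ is indecomposable if and only if $(\underline{a},b)\in\mathbb{C}^{k+1,\mathrm{reg}}$ and all entries of $S$ are nonzero. (3) Suppose $k=1$, so $(a,\underline{b})\in\mathbb{C}^{1+\ell}$. Then $V$ is indecomposable if and only if $(a,\underline{b})\in\mathbb{C}^{1+\ell,\mathrm{reg}}$ and all entries of $S$ are nonzero.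
   Context: $A$ denotes the degenerate affine periplectic Brauer algebra on $2$ strands: the associative unital $\mathbb{C}$-algebra generated by $s,y_1,y_2,e$ with relations $$s^2=1,\quad y_1y_2=y_2y_1,\quad sy_1=y_2s-1-e,\quad sy_2=y_1s+1-e,$$ $$e^2=0,\quad es=e,\quad se=-e,\quad ey_2=ey_1+e,\quad y_1e=y_2e+e.$$ A representation of $A$ is called calibrated if it has a basis with respect to which $y_1$ and $y_2$ both act by diagonal matrices. $\mathbb{N}=\{1,2,\dots\}$. A vector in $\mathbb{C}^{k+\ell}$ is written $(\underline{a},\underline{b})=(a_1,\dots,a_k,b_1,\dots,b_\ell)$. For $k,\ell\in\mathbb{N}$, $S\in M_{k\times\ell}(\mathbb{C})$ and $(\underline{a},\underline{b})\in\mathbb{C}^{k+\ell}$, the representation $V_{k,\ell}(S;(\underline{a},\underline{b}))$ of $A$ is the vector space $\mathbb{C}^{k+\ell}$ on which the generators act by the matrices $$y_1=\mathrm{diag}(a_1,\dots,a_k,b_1-1,\dots,b_\ell-1),\quad y_2=\mathrm{diag}(a_1-1,\dots,a_k-1,b_1,\dots,b_\ell),$$ $$s=\begin{pmatrix}-\mathrm{Id}_k&S\\0&\mathrm{Id}_\ell\end{pmatrix},\quad e=-sy_2+y_1s+\mathrm{Id}_{k+\ell}.$$ Regular vectors: $\mathbb{C}^{k+\ell,\mathrm{reg}}=\{(\underline{a},\underline{b})\in\mathbb{C}^{k+\ell}\mid a_i\neq a_j\text{ for all }1\le i<j\le k\text{ and } b_m\neq b_n\text{ for all }1\le m<n\le\ell\}$.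 Rhizomatic matrices: for $S=(s_{ij})\in M_{k\times\ell}(\mathbb{C})$, let $\sim$ be the equivalence relation on the (positions of) nonzero entries of $S$ generated by $s_{ij}\sim s_{mn}$ whenever $i=m$ or $j=n$. $S$ is rhizomatic if (i) there is a single equivalence class of nonzero entries of $S$ under $\sim$, and (ii) $S$ has a nonzero entry in every row and every column. *)

theory Defs
  imports "HOL-Analysis.Analysis"
begin

text \<open>
  The degenerate affine periplectic Brauer algebra on two strands is given by generators and
  relations, so a representation of it is a complex vector space with four linear operators
  satisfying these relations, and a subspace is a subrepresentation iff it is stable under the
  four generators.  A product \<open>x y\<close> in the algebra acts by \<open>v \<mapsto> x (y v)\<close>.
\<close>

locale periplectic_brauer_rep = vector_space scale
  for scale :: "complex \<Rightarrow> 'v::ab_group_add \<Rightarrow> 'v" +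
  fixes s y1 y2 e :: "'v \<Rightarrow> 'v"
  assumes linear_s: "Vector_Spaces.linear scale scale s"
    and linear_y1: "Vector_Spaces.linear scale scale y1"
    and linear_y2: "Vector_Spaces.linear scale scale y2"
    and linear_e: "Vector_Spaces.linear scale scale e"
    and s_s: "s (s v) = v"
    and y1_y2: "y1 (y2 v) = y2 (y1 v)"
    and s_y1: "s (y1 v) = y2 (s v) - v - e v"
    and s_y2: "s (y2 v) = y1 (s v) + v - e v"
    and e_e: "e (e v) = 0"
    and e_s: "e (s v) = e v"
    and s_e: "s (e v) = - e v"
    and e_y2: "e (y2 v) = e (y1 v) + e v"
    and y1_e: "y1 (e v) = y2 (e v) + e v"
begin

definition subrepresentation :: "'v set \<Rightarrow> bool" where
  "subrepresentation U \<longleftrightarrow> subspace U \<and>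
     s ` U \<subseteq> U \<and> y1 ` U \<subseteq> U \<and> y2 ` U \<subseteq> U \<and> e ` U \<subseteq> U"

definition indecomposable :: bool where
  "indecomposable \<longleftrightarrow> (UNIV :: 'v set) \<noteq> {0} \<and>
     (\<forall>U W. subrepresentation U \<and> subrepresentation W \<and>
        U \<inter> W = {0} \<and> {u + w | u w. u \<in> U \<and> w \<in> W} = UNIV \<longrightarrow> U = {0} \<or> W = {0})"

definition calibrated :: bool where
  "calibrated \<longleftrightarrow> (\<exists>B. independent B \<and> span B = UNIV \<and>
     (\<forall>v\<in>B. (\<exists>c. y1 v = scale c v) \<and> (\<exists>c. y2 v = scale c v)))"

end

text \<open>
  Sizes \<open>k\<close> and \<open>\<ell>\<close> are the cardinalities of the nonempty finite index types \<open>'k\<close> and \<open>'l\<close>;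
  a \<open>k \<times> \<ell>\<close> matrix has type \<open>complex ^ 'l ^ 'k\<close>, and the space of dimension \<open>k + \<ell>\<close> is
  \<open>complex ^ ('k + 'l)\<close>, with \<open>Inl\<close> indexing the first \<open>k\<close> coordinates.
\<close>

definition V_y1 :: "complex ^ 'k::finite \<Rightarrow> complex ^ 'l::finite \<Rightarrow> complex ^ ('k + 'l) ^ ('k + 'l)" where
  "V_y1 a b = (\<chi> p q. if p = q then (case p of Inl i \<Rightarrow> a $ i | Inr j \<Rightarrow> b $ j - 1) else 0)"

definition V_y2 :: "complex ^ 'k::finite \<Rightarrow> complex ^ 'l::finite \<Rightarrow> complex ^ ('k + 'l) ^ ('k + 'l)" where
  "V_y2 a b = (\<chi> p q. if p = q then (case p of Inl i \<Rightarrow> a $ i - 1 | Inr j \<Rightarrow> b $ j) else 0)"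

definition V_s :: "complex ^ 'l::finite ^ 'k::finite \<Rightarrow> complex ^ ('k + 'l) ^ ('k + 'l)" where
  "V_s S = (\<chi> p q. case p of
      Inl i \<Rightarrow> (case q of Inl i' \<Rightarrow> (if i = i' then - 1 else 0) | Inr j \<Rightarrow> S $ i $ j)
    | Inr j \<Rightarrow> (case q of Inl i \<Rightarrow> 0 | Inr j' \<Rightarrow> (if j = j' then 1 else 0)))"

definition V_e :: "complex ^ 'l::finite ^ 'k::finite \<Rightarrow> complex ^ 'k \<Rightarrow> complex ^ 'l
    \<Rightarrow> complex ^ ('k + 'l) ^ ('k + 'l)" where
  "V_e S a b = - (V_s S ** V_y2 a b) + V_y1 a b ** V_s S + mat 1"

definition regular_vectors :: "((complex ^ 'k::finite) \<times> (complex ^ 'l::finite)) set" where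
  "regular_vectors = {(a, b). (\<forall>i j. i \<noteq> j \<longrightarrow> a $ i \<noteq> a $ j) \<and> (\<forall>m n. m \<noteq> n \<longrightarrow> b $ m \<noteq> b $ n)}"

definition nonzero_positions :: "complex ^ 'l::finite ^ 'k::finite \<Rightarrow> ('k \<times> 'l) set" where
  "nonzero_positions S = {(i, j). S $ i $ j \<noteq> 0}"

definition linked :: "complex ^ 'l::finite ^ 'k::finite \<Rightarrow> 'k \<times> 'l \<Rightarrow> 'k \<times> 'l \<Rightarrow> bool" where
  "linked S p q \<longleftrightarrow> p \<in> nonzero_positions S \<and> q \<in> nonzero_positions S \<and>
     (fst p = fst q \<or> snd p = snd q)"

definition rhizome_rel :: "complex ^ 'l::finite ^ 'k::finite \<Rightarrow> (('k \<times> 'l) \<times> ('k \<times> 'l)) set" where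
  "rhizome_rel S = {(p, q) \<in> nonzero_positions S \<times> nonzero_positions S. equivclp (linked S) p q}"

definition rhizomatic :: "complex ^ 'l::finite ^ 'k::finite \<Rightarrow> bool" where
  "rhizomatic S \<longleftrightarrow> (\<exists>!C. C \<in> nonzero_positions S // rhizome_rel S) \<and>
     (\<forall>i. \<exists>j. S $ i $ j \<noteq> 0) \<and> (\<forall>j. \<exists>i. S $ i $ j \<noteq> 0)"

lemma sum_UNIV_Plus:
  fixes f :: "'k::finite + 'l::finite \<Rightarrow> complex"
  shows "sum f UNIV = (\<Sum>i\<in>UNIV. f (Inl i)) + (\<Sum>j\<in>UNIV. f (Inr j))"
  by (simp add: UNIV_Plus_UNIV[symmetric] sum.Plus del: UNIV_Plus_UNIV)

lemma V_y1_apply [simp]: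
  "(V_y1 a b *v v) $ Inl i = a $ i * v $ Inl i"
  "(V_y1 a b *v v) $ Inr j = (b $ j - 1) * v $ Inr j"
  by (simp_all add: V_y1_def matrix_vector_mult_def if_distrib[of "\<lambda>x. x * _"] cong: if_cong)

lemma V_y2_apply [simp]:
  "(V_y2 a b *v v) $ Inl i = (a $ i - 1) * v $ Inl i"
  "(V_y2 a b *v v) $ Inr j = b $ j * v $ Inr j"
  by (simp_all add: V_y2_def matrix_vector_mult_def if_distrib[of "\<lambda>x. x * _"] cong: if_cong)

lemma V_s_apply [simp]:
  "(V_s S *v v) $ Inl i = - v $ Inl i + (\<Sum>j\<in>UNIV. S $ i $ j * v $ Inr j)"
  "(V_s S *v v) $ Inr j = v $ Inr j"
  by (simp_all add: V_s_def matrix_vector_mult_def sum_UNIV_Plus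
      if_distrib[of "\<lambda>x. x * _"] cong: if_cong)

lemma V_e_mult:
  "V_e S a b *v v = - (V_s S *v (V_y2 a b *v v)) + V_y1 a b *v (V_s S *v v) + v"
  by (simp add: V_e_def matrix_vector_mult_add_rdistrib matrix_vector_mult_diff_rdistrib
      matrix_vector_mul_assoc)

lemma V_e_apply [simp]:
  "(V_e S a b *v v) $ Inl i = (\<Sum>j\<in>UNIV. (a $ i - b $ j) * S $ i $ j * v $ Inr j)"
  "(V_e S a b *v v) $ Inr j = 0"
  by (simp_all add: V_e_mult algebra_simps sum_distrib_left sum_subtractf)

lemma vec_eq_Plus_iff:
  fixes v w :: "complex ^ ('k::finite + 'l::finite)"
  shows "v = w \<longleftrightarrow> (\<forall>i. v $ Inl i = w $ Inl i) \<and> (\<forall>j. v $ Inr j = w $ Inr j)"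
  by (metis vec_eq_iff sum.exhaust)

lemma V_representation:
  "periplectic_brauer_rep (*s) ((*v) (V_s S)) ((*v) (V_y1 a b)) ((*v) (V_y2 a b)) ((*v) (V_e S a b))"
proof (intro periplectic_brauer_rep.intro periplectic_brauer_rep_axioms.intro)
  show "vector_space ((*s) :: complex \<Rightarrow> complex ^ ('a + 'b) \<Rightarrow> _)"
    by (rule vec.vector_space_axioms)
qed (simp_all add: vec_eq_Plus_iff algebra_simps sum_distrib_left sum_subtractf sum.distrib)

lemma V_calibrated:
  "periplectic_brauer_rep.calibrated (*s) ((*v) (V_y1 a b)) ((*v) (V_y2 a b))"
proof -
  interpret V: periplectic_brauer_rep "(*s)" "(*v) (V_s 0)" "(*v) (V_y1 a b)" "(*v) (V_y2 a b)"
    "(*v) (V_e 0 a b)"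
    by (rule V_representation)
  have "\<exists>c. V_y1 a b *v axis p 1 = c *s axis p 1" for p
    by (rule exI[of _ "case p of Inl i \<Rightarrow> a $ i | Inr j \<Rightarrow> b $ j - 1"])
      (auto simp: vec_eq_Plus_iff axis_def split: sum.split)
  moreover have "\<exists>c. V_y2 a b *v axis p 1 = c *s axis p 1" for p
    by (rule exI[of _ "case p of Inl i \<Rightarrow> a $ i - 1 | Inr j \<Rightarrow> b $ j"])
      (auto simp: vec_eq_Plus_iff axis_def split: sum.split)
  ultimately show ?thesis
    unfolding V.calibrated_def
    by (intro exI[of _ cart_basis]) (auto simp: independent_cart_basis, auto simp: cart_basis_def)
qed

abbreviation indecomposable_V :: "complex ^ 'l::finite ^ 'k::finite \<Rightarrow> complex ^ 'k \<Rightarrow> complex ^ 'l \<Rightarrow> bool" where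
  "indecomposable_V S a b \<equiv> periplectic_brauer_rep.indecomposable (*s)
     ((*v) (V_s S)) ((*v) (V_y1 a b)) ((*v) (V_y2 a b)) ((*v) (V_e S a b))"

end

theory Submission
  imports Defs
begin

text \<open>
  Since \<open>y\<^sub>1 - y\<^sub>2\<close> acts as \<open>1\<close> on the first \<open>k\<close> coordinates and as \<open>-1\<close> on the last \<open>\<ell>\<close>, a regular
  vector makes the joint \<open>(y\<^sub>1, y\<^sub>2)\<close>-eigenvalues of the coordinates distinct, so that every
  subrepresentation is a coordinate subspace.  A decomposition is then a splitting of the bipartite
  graph of nonzero entries of \<open>S\<close> into unions of connected components, and \<open>S\<close> is rhizomatic iff
  this graph is connected.  Conversely, for arbitrary \<open>(a, b)\<close>, the coordinate projection onto a
  component is an idempotent endomorphism.  If two rows of \<open>S\<close> are proportional (as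
  any two nonzero rows are for \<open>\<ell> = 1\<close>) and the corresponding \<open>a\<^sub>i\<close> agree, then subtracting a
  multiple of one row from the other splits off a line, and likewise for columns.
\<close>

section \<open>Idempotent endomorphisms\<close>

context periplectic_brauer_rep
begin

text \<open>As \<open>e\<close> is a polynomial in \<open>s\<close>, \<open>y1\<close>,
  \<open>y2\<close>, commutation with these three implies commutation with \<open>e\<close>.\<close>

lemma e_eq: "e v = y2 (s v) - v - s (y1 v)"
  using s_y1[of v] by simp

text \<open>The range and the kernel of \<open>p\<close> are complementary subrepresentations, so
  one of them is zero. A zero kernel forces \<open>p v = v\<close>, since the kernel contains every
  \<open>v - p v\<close>.\<close>

lemma idempotent_endomorphism_trivial:
  assumes "indecomposable"
    and lin: "Vector_Spaces.linear scale scale p"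
    and idem: "\<And>v. p (p v) = p v"
    and cs: "\<And>v. p (s v) = s (p v)"
    and c1: "\<And>v. p (y1 v) = y1 (p v)"
    and c2: "\<And>v. p (y2 v) = y2 (p v)"
  shows "(\<forall>v. p v = 0) \<or> (\<forall>v. p v = v)"
proof -
  interpret p: Vector_Spaces.linear scale scale p by (rule lin)
  interpret ls: Vector_Spaces.linear scale scale s by (rule linear_s)
  interpret l1: Vector_Spaces.linear scale scale y1 by (rule linear_y1)
  interpret l2: Vector_Spaces.linear scale scale y2 by (rule linear_y2)
  interpret le: Vector_Spaces.linear scale scale e by (rule linear_e)
  have ce: "p (e v) = e (p v)" for v
    by (simp add: e_eq p.diff cs c1 c2)
  have U: "subrepresentation (range p)"
    unfolding subrepresentation_def
    by (auto simp: p.subspace_image subspace_UNIV simp flip: cs c1 c2 ce)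
  have W: "subrepresentation {v. p v = 0}"
    unfolding subrepresentation_def
    by (auto simp: p.subspace_kernel cs c1 c2 ce ls.zero l1.zero l2.zero le.zero)
  have "range p \<inter> {v. p v = 0} = {0}"
    using idem by (auto simp: image_iff p.zero intro!: exI[of _ 0])
  moreover have "v \<in> {u + w | u w. u \<in> range p \<and> w \<in> {v. p v = 0}}" for v
  proof -
    have "v = p v + (v - p v)" "p (v - p v) = 0"
      by (simp_all add: p.diff idem)
    then show ?thesis by blast
  qed
  ultimately have "range p = {0} \<or> {v. p v = 0} = {0}"
    using assms(1) U W unfolding indecomposable_def by blast
  moreover have "p v = v" if "{v. p v = 0} = {0}" for v
  proof -
    have "p (v - p v) = 0" by (simp add: p.diff idem)
    with that have "v - p v = 0" by blast
    then show ?thesis by simp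
  qed
  ultimately show ?thesis by blast
qed

end

lemma indecomposable_V_idempotent:
  fixes S :: "complex ^ 'l::finite ^ 'k::finite"
  assumes "indecomposable_V S a b"
    and "Vector_Spaces.linear (*s) (*s) p"
    and "\<And>v. p (p v) = p v"
    and "\<And>v. p (V_s S *v v) = V_s S *v p v"
    and "\<And>v. p (V_y1 a b *v v) = V_y1 a b *v p v"
    and "\<And>v. p (V_y2 a b *v v) = V_y2 a b *v p v"
  shows "(\<forall>v. p v = 0) \<or> (\<forall>v. p v = v)"
proof -
  interpret V: periplectic_brauer_rep "(*s)" "(*v) (V_s S)" "(*v) (V_y1 a b)" "(*v) (V_y2 a b)"
    "(*v) (V_e S a b)"
    by (rule V_representation)
  show ?thesis
    by (rule V.idempotent_endomorphism_trivial[of p]) (fact assms)+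
qed

text \<open>If \<open>a $ i = a $ m\<close>, the functional \<open>v $ Inl i - c * v $ Inl m\<close>
  is an eigenfunctional of \<open>s\<close>, because the rows cancel, and of both diagonal
  operators. Its eigenvalues are those of \<open>axis (Inl i) 1\<close>, so their product
  \<open>p\<close> commutes with the action.\<close>

lemma indecomposable_V_rows:
  fixes S :: "complex ^ 'l::finite ^ 'k::finite"
  assumes ind: "indecomposable_V S a b"
    and "i \<noteq> m" and row: "\<And>j. S $ i $ j = c * S $ m $ j"
  shows "a $ i \<noteq> a $ m"
proof
  assume eq: "a $ i = a $ m"
  define p :: "complex ^ ('k + 'l) \<Rightarrow> complex ^ ('k + 'l)"
    where "p v = (v $ Inl i - c * v $ Inl m) *s axis (Inl i) 1" for v
  have p_nth: "p v $ Inl n = (if n = i then v $ Inl i - c * v $ Inl m else 0)"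
      "p v $ Inr j = 0" for v n j
    by (simp_all add: p_def axis_def)
  have "(\<forall>v. p v = 0) \<or> (\<forall>v. p v = v)"
  proof (rule indecomposable_V_idempotent[OF ind])
    show "Vector_Spaces.linear (*s) (*s) p"
      by (intro Vector_Spaces.linear.intro vec.vector_space_axioms)
        (unfold_locales, simp_all add: vec_eq_Plus_iff p_nth algebra_simps)
  qed (use eq \<open>i \<noteq> m\<close> in \<open>auto simp: vec_eq_Plus_iff p_nth row algebra_simps sum_distrib_left\<close>)
  \<comment> \<open>The vector of \<open>i\<close> is fixed by \<open>p\<close>, that of
    \<open>m\<close> is sent into the line of the former: \<open>p\<close> is neither zero nor the
    identity.\<close>
  moreover have "p (axis (Inl i) 1) $ Inl i = 1"
    using \<open>i \<noteq> m\<close> by (simp add: p_nth axis_def)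
  moreover have "p (axis (Inl m) 1) $ Inl m \<noteq> axis (Inl m) 1 $ Inl m"
    using \<open>i \<noteq> m\<close> by (simp add: p_nth axis_def)
  ultimately show False by (metis zero_index zero_neq_one)
qed

text \<open>Dual to the case of rows: the joint eigenvector is now
  \<open>axis (Inr j) 1 - c *s axis (Inr n) 1\<close>, on which the columns cancel, and the
  functional is the coordinate \<open>v $ Inr j\<close>, which \<open>s\<close> preserves.\<close>

lemma indecomposable_V_columns:
  fixes S :: "complex ^ 'l::finite ^ 'k::finite"
  assumes ind: "indecomposable_V S a b"
    and "j \<noteq> n" and column: "\<And>i. S $ i $ j = c * S $ i $ n"
  shows "b $ j \<noteq> b $ n"
proof
  assume eq: "b $ j = b $ n"
  define p :: "complex ^ ('k + 'l) \<Rightarrow> complex ^ ('k + 'l)"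
    where "p v = v $ Inr j *s (axis (Inr j) 1 - c *s axis (Inr n) 1)" for v
  have p_nth: "p v $ Inl i = 0"
      "p v $ Inr m = (if m = j then v $ Inr j else if m = n then - c * v $ Inr j else 0)" for v i m
    using \<open>j \<noteq> n\<close> by (simp_all add: p_def axis_def)
  have kernel: "(\<Sum>m\<in>UNIV. S $ i $ m * p v $ Inr m) = 0" for v i
  proof -
    have "(\<Sum>m\<in>UNIV. S $ i $ m * p v $ Inr m)
        = (\<Sum>m\<in>{j, n}. S $ i $ m * p v $ Inr m)"
      by (rule sum.mono_neutral_right) (auto simp: p_nth)
    then show ?thesis using \<open>j \<noteq> n\<close> by (simp add: p_nth column)
  qed
  have "(\<forall>v. p v = 0) \<or> (\<forall>v. p v = v)"
  proof (rule indecomposable_V_idempotent[OF ind])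
    show "Vector_Spaces.linear (*s) (*s) p"
      by (intro Vector_Spaces.linear.intro vec.vector_space_axioms)
        (unfold_locales, simp_all add: vec_eq_Plus_iff p_nth algebra_simps)
    show "p (V_s S *v v) = V_s S *v p v" for v
      by (simp add: vec_eq_Plus_iff kernel) (simp add: p_nth)
  qed (use eq \<open>j \<noteq> n\<close> in \<open>auto simp: vec_eq_Plus_iff p_nth algebra_simps\<close>)
  moreover have "p (axis (Inr j) 1) $ Inr j = 1"
    by (simp add: p_nth axis_def)
  moreover have "p (axis (Inr n) 1) $ Inr n \<noteq> axis (Inr n) 1 $ Inr n"
    using \<open>j \<noteq> n\<close> by (simp add: p_nth axis_def)
  ultimately show False by (metis zero_index zero_neq_one)
qed


section \<open>Rhizomatic matrices\<close>

lemma equiv_rhizome_rel: "equiv (nonzero_positions S) (rhizome_rel S)"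
  unfolding rhizome_rel_def
  by (intro equivI refl_onI symI transI) (auto intro: equivclp_sym equivclp_trans)

text \<open>Replaces quotient classes by pairwise linkage, the form in which connectedness is both
  proved and used.\<close>

lemma Ex1_rhizome_class_iff:
  "(\<exists>!C. C \<in> nonzero_positions S // rhizome_rel S) \<longleftrightarrow>
    nonzero_positions S \<noteq> {} \<and>
    (\<forall>p\<in>nonzero_positions S. \<forall>q\<in>nonzero_positions S. equivclp (linked S) p q)"
    (is "?L \<longleftrightarrow> ?R")
proof
  assume L: ?L
  then have "nonzero_positions S \<noteq> {}"
    by (auto simp: quotient_def)
  moreover have "equivclp (linked S) p q"
    if "p \<in> nonzero_positions S" "q \<in> nonzero_positions S" for p q
  proof -
    have "rhizome_rel S `` {p} = rhizome_rel S `` {q}"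
      using L that by (blast intro: quotientI)
    then have "(p, q) \<in> rhizome_rel S"
      using equiv_rhizome_rel that by (metis eq_equiv_class)
    then show ?thesis by (simp add: rhizome_rel_def)
  qed
  ultimately show ?R by blast
next
  assume R: ?R
  then obtain p where p: "p \<in> nonzero_positions S" by blast
  show ?L
  proof (rule ex1I)
    show "rhizome_rel S `` {p} \<in> nonzero_positions S // rhizome_rel S"
      using p by (rule quotientI)
    fix C assume "C \<in> nonzero_positions S // rhizome_rel S"
    then obtain q where q: "q \<in> nonzero_positions S" "C = rhizome_rel S `` {q}"
      by (auto elim: quotientE)
    then have "(q, p) \<in> rhizome_rel S"
      using R p by (auto simp: rhizome_rel_def)
    then show "C = rhizome_rel S `` {p}"
      using q equiv_rhizome_rel by (metis equiv_class_eq)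
  qed
qed

lemma rhizomatic_if_nonzero:
  fixes S :: "complex ^ 'l::finite ^ 'k::finite"
  assumes nz: "\<And>i j. S $ i $ j \<noteq> 0"
  shows "rhizomatic S"
proof -
  have "equivclp (linked S) (i, j) (m, n)" for i j m n
  proof -
    \<comment> \<open>The corner \<open>(i, n)\<close> lies in the row of one position and in the
      column of the other.\<close>
    have "linked S (i, j) (i, n)" "linked S (i, n) (m, n)"
      by (simp_all add: linked_def nonzero_positions_def nz)
    then show ?thesis by (meson equivclp_trans r_into_equivclp)
  qed
  moreover have "nonzero_positions S \<noteq> {}"
    by (auto simp: nonzero_positions_def nz)
  ultimately show ?thesis
    unfolding rhizomatic_def Ex1_rhizome_class_iff using nz by auto
qed


section \<open>Indecomposability and rhizomatic matrices\<close>

lemma indecomposable_V_imp_rhizomatic: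
  fixes S :: "complex ^ 'l::finite ^ 'k::finite"
  assumes ind: "indecomposable_V S a b" and "S \<noteq> 0"
  shows "rhizomatic S"
proof -
  \<comment> \<open>The component of a nonzero entry meets every row and every column, because the
    projection \<open>P\<close> onto its coordinates must be the identity.\<close>
  have component: "(\<exists>j. equivclp (linked S) p (i, j) \<and> S $ i $ j \<noteq> 0) \<and>
      (\<exists>i. equivclp (linked S) p (i, j) \<and> S $ i $ j \<noteq> 0)"
    if p: "p \<in> nonzero_positions S" for p i j
  proof -
    define I where "I = {i. \<exists>j. equivclp (linked S) p (i, j) \<and> S $ i $ j \<noteq> 0}"
    define J where "J = {j. \<exists>i. equivclp (linked S) p (i, j) \<and> S $ i $ j \<noteq> 0}"
    have IJ: "i \<in> I \<longleftrightarrow> j \<in> J" if nz: "S $ i $ j \<noteq> 0" for i j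
    proof -
      have "equivclp (linked S) p (i, j)"
        if "equivclp (linked S) p q" "q \<in> nonzero_positions S" "fst q = i \<or> snd q = j" for q
      proof -
        have "linked S q (i, j)"
          using that nz by (auto simp: linked_def nonzero_positions_def)
        with that show ?thesis by (meson equivclp_trans r_into_equivclp)
      qed
      then show ?thesis
        using nz unfolding I_def J_def nonzero_positions_def by fastforce
    qed
    define P :: "complex ^ ('k + 'l) \<Rightarrow> complex ^ ('k + 'l)"
      where "P v = (\<chi> x. if x \<in> Inl ` I \<union> Inr ` J then v $ x else 0)" for v
    have P_nth: "P v $ Inl i = (if i \<in> I then v $ Inl i else 0)"
        "P v $ Inr j = (if j \<in> J then v $ Inr j else 0)" for v i j
      by (auto simp: P_def)
    \<comment> \<open>By \<open>IJ\<close>, entries with exactly one of \<open>i \<in> I\<close> and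
      \<open>j \<in> J\<close> vanish, so truncation may be done before or after
      \<open>S\<close>.\<close>
    have P_s: "(if i \<in> I then (\<Sum>j\<in>UNIV. S $ i $ j * v $ Inr j) else 0)
        = (\<Sum>j\<in>UNIV. S $ i $ j * (if j \<in> J then v $ Inr j else 0))"
      for v :: "complex ^ ('k + 'l)" and i
    proof -
      have "(\<Sum>j\<in>UNIV. S $ i $ j * (if j \<in> J then v $ Inr j else 0))
          = (\<Sum>j\<in>UNIV. if i \<in> I then S $ i $ j * v $ Inr j else 0)"
        using IJ by (intro sum.cong) auto
      then show ?thesis by simp
    qed
    have "(\<forall>v. P v = 0) \<or> (\<forall>v. P v = v)"
    proof (rule indecomposable_V_idempotent[OF ind])
      show "Vector_Spaces.linear (*s) (*s) P"
        by (intro Vector_Spaces.linear.intro vec.vector_space_axioms)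
          (unfold_locales, simp_all add: vec_eq_Plus_iff P_nth)
      show "P (V_s S *v v) = V_s S *v P v" for v
        by (simp add: vec_eq_Plus_iff P_nth flip: P_s)
    qed (simp_all add: vec_eq_Plus_iff P_nth)
    moreover have "fst p \<in> I"
      unfolding I_def using p by (auto simp: nonzero_positions_def intro!: exI[of _ "snd p"])
    then have "P (axis (Inl (fst p)) 1) $ Inl (fst p) = 1"
      by (simp add: P_nth axis_def)
    ultimately have P_id: "P v = v" for v
      by (metis zero_index zero_neq_one)
    have "i \<in> I" "j \<in> J"
      using arg_cong[OF P_id, of "\<lambda>v. v $ Inl i" "axis (Inl i) 1"]
        arg_cong[OF P_id, of "\<lambda>v. v $ Inr j" "axis (Inr j) 1"]
      by (auto simp: P_nth axis_def split: if_splits)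
    then show ?thesis by (simp add: I_def J_def)
  qed
  obtain p where p: "p \<in> nonzero_positions S"
    using \<open>S \<noteq> 0\<close> by (auto simp: nonzero_positions_def vec_eq_iff)
  have "equivclp (linked S) p q"
    if p: "p \<in> nonzero_positions S" and q: "q \<in> nonzero_positions S" for p q
  proof -
    \<comment> \<open>The component of \<open>p\<close> meets the row of \<open>q\<close>, and an
      entry there is linked to \<open>q\<close>.\<close>
    obtain j where j: "equivclp (linked S) p (fst q, j)" "S $ fst q $ j \<noteq> 0"
      using component[OF p] by blast
    then have "linked S (fst q, j) q"
      using q by (simp add: linked_def nonzero_positions_def)
    with j show ?thesis by (meson equivclp_trans r_into_equivclp)
  qed
  then show ?thesis
    unfolding rhizomatic_def Ex1_rhizome_class_iff using p component[OF p] by blast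
qed

text \<open>As in Lagrange interpolation, the diagonal operator of \<open>d\<close> minus the scalar
  \<open>d $ q\<close> kills coordinate \<open>q\<close> and keeps coordinate \<open>p\<close>
  nonzero. Doing this for all \<open>q \<noteq> p\<close> leaves a nonzero multiple of
  \<open>axis p 1\<close>.\<close>

lemma axis_in_diagonal_stable_subspace:
  fixes U :: "(complex ^ 'n::finite) set"
  assumes U: "vec.subspace U"
    and sep: "\<And>p q. p \<noteq> q \<Longrightarrow> \<exists>d. d $ p \<noteq> d $ q \<and> (\<forall>v\<in>U. (\<chi> r. d $ r * v $ r) \<in> U)"
    and u: "u \<in> U" "u $ p \<noteq> 0"
  shows "axis p 1 \<in> U"
proof -
  have "\<exists>v\<in>U. v $ p \<noteq> 0 \<and> (\<forall>q\<in>F. v $ q = 0)" if "p \<notin> F" for F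
    using finite[of F] that
  proof (induction F rule: finite_induct)
    case empty
    then show ?case using u by blast
  next
    case (insert q F)
    then obtain v where v: "v \<in> U" "v $ p \<noteq> 0" "\<forall>q\<in>F. v $ q = 0" by auto
    obtain d where d: "d $ p \<noteq> d $ q" "(\<chi> r. d $ r * v $ r) \<in> U"
      using sep[of p q] insert.prems v(1) by auto
    have "(\<chi> r. d $ r * v $ r) - d $ q *s v \<in> U"
      using U d(2) v(1) by (intro vec.subspace_diff vec.subspace_scale)
    then show ?case
      using d(1) v(2,3) by (intro bexI[of _ "(\<chi> r. d $ r * v $ r) - d $ q *s v"]) auto
  qed
  from this[of "UNIV - {p}"] obtain v where v: "v \<in> U" "v $ p \<noteq> 0" "\<forall>q. q \<noteq> p \<longrightarrow> v $ q = 0"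
    by auto
  then have "axis p 1 = (1 / v $ p) *s v"
    by (auto simp: vec_eq_iff axis_def)
  then show ?thesis using U v(1) by (metis vec.subspace_scale)
qed

lemma rhizomatic_imp_indecomposable_V:
  fixes S :: "complex ^ 'l::finite ^ 'k::finite"
  assumes rh: "rhizomatic S" and reg: "(a, b) \<in> regular_vectors"
  shows "indecomposable_V S a b"
proof -
  interpret V: periplectic_brauer_rep "(*s)" "(*v) (V_s S)" "(*v) (V_y1 a b)" "(*v) (V_y2 a b)"
    "(*v) (V_e S a b)"
    by (rule V_representation)
  let ?d1 = "\<chi> x. case x of Inl i \<Rightarrow> a $ i | Inr j \<Rightarrow> b $ j - 1"
  let ?d2 = "\<chi> x. case x of Inl i \<Rightarrow> a $ i - 1 | Inr j \<Rightarrow> b $ j"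
  have diag: "(\<chi> x. ?d1 $ x * v $ x) = V_y1 a b *v v" "(\<chi> x. ?d2 $ x * v $ x) = V_y2 a b *v v" for v
    by (simp_all add: vec_eq_Plus_iff)
  have axis_mem: "axis x 1 \<in> U" if U: "V.subrepresentation U" and u: "u \<in> U" "u $ x \<noteq> 0" for U u x
  proof (rule axis_in_diagonal_stable_subspace[of U u x])
    show "vec.subspace U" using U by (simp add: V.subrepresentation_def)
    fix p q :: "'k + 'l" assume "p \<noteq> q"
    \<comment> \<open>Within a block regularity separates. Across blocks the two diagonals cannot
      both agree, as \<open>?d1 - ?d2\<close> is 1 on \<open>Inl\<close> and -1 on
      \<open>Inr\<close>.\<close>
    then have "?d1 $ p \<noteq> ?d1 $ q \<or> ?d2 $ p \<noteq> ?d2 $ q"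
      using reg by (cases p; cases q) (auto simp: regular_vectors_def algebra_simps)
    moreover have "(\<chi> x. ?d1 $ x * v $ x) \<in> U" "(\<chi> x. ?d2 $ x * v $ x) \<in> U" if "v \<in> U" for v
      using U that unfolding diag V.subrepresentation_def by auto
    ultimately show "\<exists>d. d $ p \<noteq> d $ q \<and> (\<forall>v\<in>U. (\<chi> r. d $ r * v $ r) \<in> U)"
      by (elim disjE) (rule exI[of _ ?d1] exI[of _ ?d2], blast)+
  qed (use u in auto)
  have edge: "axis (Inl i) 1 \<in> U"
    if U: "V.subrepresentation U" and "axis (Inr j) 1 \<in> U" "S $ i $ j \<noteq> 0" for U i j
  proof (rule axis_mem[OF U])
    show "V_s S *v axis (Inr j) 1 \<in> U"
      using that by (auto simp: V.subrepresentation_def)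
    show "(V_s S *v axis (Inr j) 1) $ Inl i \<noteq> 0"
      using that(3) by (simp add: axis_def if_distrib[of "\<lambda>x. _ * x"] cong: if_cong)
  qed
  have full: "U = UNIV" if "V.subrepresentation U" "\<And>x. axis x 1 \<in> U" for U
  proof -
    have "(\<Sum>x\<in>UNIV. v $ x *s axis x 1) \<in> U" for v
      using that by (intro vec.subspace_sum vec.subspace_scale) (auto simp: V.subrepresentation_def)
    then show ?thesis by (auto simp: basis_expansion)
  qed
  have "U = {0} \<or> W = {0}"
    if U: "V.subrepresentation U" and W: "V.subrepresentation W"
      and int: "U \<inter> W = {0}" and sum: "{u + w | u w. u \<in> U \<and> w \<in> W} = UNIV" for U W
  proof -
    have either: "axis x 1 \<in> U \<or> axis x 1 \<in> W" for x
    proof -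
      obtain u w where uw: "axis x 1 = u + w" "u \<in> U" "w \<in> W" using sum by blast
      then have "u $ x + w $ x = 1" by (metis axis_nth vector_add_component)
      then have "u $ x \<noteq> 0 \<or> w $ x \<noteq> 0" by auto
      then show ?thesis using uw axis_mem U W by blast
    qed
    have not_both: "\<not> (axis x 1 \<in> U \<and> axis x 1 \<in> W)" for x
    proof
      assume "axis x 1 \<in> U \<and> axis x 1 \<in> W"
      then have "axis x (1::complex) = 0" using int by blast
      then show False by (simp add: axis_eq_0_iff)
    qed
    \<comment> \<open>\<open>edge\<close> leads only from column to row. Conversely, a column vector
      outside \<open>U\<close> lies in \<open>W\<close> and brings the row vector into
      \<open>W\<close>, hence out of \<open>U\<close>.\<close>
    have edge_iff: "axis (Inl i) 1 \<in> U \<longleftrightarrow> axis (Inr j) 1 \<in> U" if "S $ i $ j \<noteq> 0" for i j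
      using edge[OF U] edge[OF W] either not_both that by metis
    \<comment> \<open>Linked entries in one column share their vector; those in one row are joined
      through the row vector by two uses of \<open>edge_iff\<close>.\<close>
    have const: "axis (Inr (snd p)) 1 \<in> U \<longleftrightarrow> axis (Inr (snd q)) 1 \<in> U"
      if "equivclp (linked S) p q" for p q
      using that
    proof (induction rule: equivclp_induct)
      case (step q r)
      then have "axis (Inr (snd q)) 1 \<in> U \<longleftrightarrow> axis (Inr (snd r)) 1 \<in> U"
        by (auto simp: linked_def nonzero_positions_def dest!: edge_iff)
      with step show ?case by simp
    qed simp
    from rh obtain p where p: "p \<in> nonzero_positions S"
      and single: "\<And>q. q \<in> nonzero_positions S \<Longrightarrow> equivclp (linked S) p q"
      unfolding rhizomatic_def Ex1_rhizome_class_iff by blast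
    \<comment> \<open>Every row and column has a nonzero entry, which is linked to \<open>p\<close>,
      so all axis vectors lie on the same side as the column of \<open>p\<close>.\<close>
    have all: "axis x 1 \<in> U \<longleftrightarrow> axis (Inr (snd p)) 1 \<in> U" for x
    proof -
      obtain i j where ij: "S $ i $ j \<noteq> 0" "x = Inl i \<or> x = Inr j"
        using rh unfolding rhizomatic_def by (metis sum.exhaust)
      then have "equivclp (linked S) p (i, j)"
        by (intro single) (simp add: nonzero_positions_def)
      from const[OF this] ij edge_iff show ?thesis by auto
    qed
    have "U = UNIV \<or> W = UNIV"
      using all either full U W by blast
    with int show ?thesis by auto
  qed
  moreover have "(UNIV :: (complex ^ ('k + 'l)) set) \<noteq> {0}"
  proof
    assume "(UNIV :: (complex ^ ('k + 'l)) set) = {0}"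
    then have "axis x 1 = (0 :: complex ^ ('k + 'l))" for x by auto
    then show False by (simp add: axis_eq_0_iff)
  qed
  ultimately show ?thesis unfolding V.indecomposable_def by blast
qed

theorem theorem17:
  fixes S :: "complex ^ 'l::finite ^ 'k::finite"
    and a :: "complex ^ 'k" and b :: "complex ^ 'l"
  assumes "(*v) (V_e S a b) \<noteq> (\<lambda>v. 0)"
  shows "((a, b) \<in> regular_vectors \<longrightarrow> (indecomposable_V S a b \<longleftrightarrow> rhizomatic S)) \<and>
    (CARD('l) = 1 \<longrightarrow> (indecomposable_V S a b \<longleftrightarrow>
      (a, b) \<in> regular_vectors \<and> (\<forall>i j. S $ i $ j \<noteq> 0))) \<and>
    (CARD('k) = 1 \<longrightarrow> (indecomposable_V S a b \<longleftrightarrow>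
      (a, b) \<in> regular_vectors \<and> (\<forall>i j. S $ i $ j \<noteq> 0)))"
proof -
  have "S \<noteq> 0"
  proof
    assume "S = 0"
    then have "V_e S a b *v v = 0" for v
      by (simp add: vec_eq_Plus_iff)
    with assms show False by auto
  qed
  then have rh: "rhizomatic S" if "indecomposable_V S a b"
    using that by (rule indecomposable_V_imp_rhizomatic[rotated])
  have "(a, b) \<in> regular_vectors \<and> (\<forall>i j. S $ i $ j \<noteq> 0)"
    if card: "CARD('l) = 1" and ind: "indecomposable_V S a b"
  proof -
    have one: "j = n" for j n :: 'l
      using card by (metis UNIV_I card_1_singletonE singletonD)
    \<comment> \<open>With a single column, the nonzero entry that \<open>rhizomatic\<close>
      provides in each row is the whole row.\<close>
    have nz: "S $ i $ j \<noteq> 0" for i j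
      using rh[OF ind] one unfolding rhizomatic_def by metis
    have "a $ i \<noteq> a $ m" if "i \<noteq> m" for i m
    proof (rule indecomposable_V_rows[OF ind that])
      fix j
      \<comment> \<open>\<open>undefined\<close> names the only column, so the quotient of its two
        entries is the factor between the rows.\<close>
      show "S $ i $ j = (S $ i $ undefined / S $ m $ undefined) * S $ m $ j"
        using one[of j undefined] nz by simp
    qed
    then show ?thesis using nz one by (simp add: regular_vectors_def)
  qed
  moreover have "(a, b) \<in> regular_vectors \<and> (\<forall>i j. S $ i $ j \<noteq> 0)"
    if card: "CARD('k) = 1" and ind: "indecomposable_V S a b"
  proof -
    have one: "i = m" for i m :: 'k
      using card by (metis UNIV_I card_1_singletonE singletonD)
    have nz: "S $ i $ j \<noteq> 0" for i j
      using rh[OF ind] one unfolding rhizomatic_def by metis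
    have "b $ j \<noteq> b $ n" if "j \<noteq> n" for j n
    proof (rule indecomposable_V_columns[OF ind that])
      fix i
      show "S $ i $ j = (S $ undefined $ j / S $ undefined $ n) * S $ i $ n"
        using one[of i undefined] nz by simp
    qed
    then show ?thesis using nz one by (simp add: regular_vectors_def)
  qed
  ultimately show ?thesis
    using rh rhizomatic_if_nonzero rhizomatic_imp_indecomposable_V by blast
qed

end
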